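(* The permutahedron $\mathcal{P}^{\mathrm{adj}}_n$ admits a $2$-rainbow cycle for every $n\ge 5$, and a $3$-rainbow cycle for every odd $n\ge 3$.
   Context: $S_n$ is the set of permutations of $[n]$ in one-line notation. The permutahedron $\mathcal{P}^{\mathrm{adj}}_n$ is the graph on $S_n$ in which two permutations are adjacent iff one is obtained from the other by an adjacent transposition $(i,i+1)$, $i\in[n-1]$, i.e. by swapping the entries in positions $i$ and $i+1$; the edge is colored by $(i,i+1)$. An $r$-rainbow cycle is a cyclic sequence of pairwise distinct permutations, consecutive ones (including last and first) adjacent, in which each of the $n-1$ adjacent transpositions is used in exactly $r$ steps. *)

theory Defs
  imports "HOL-Combinatorics.Multiset_Permutations"
begin

text \<open>Permutations of \<open>[n]\<close> in one-line notation are the lists containing each of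
  \<open>1, \<dots>, n\<close> exactly once.\<close>

abbreviation one_line_perms :: "nat \<Rightarrow> nat list set" where
  "one_line_perms n \<equiv> permutations_of_set {1..n}"

text \<open>Positions are counted from 1, whereas list indices are counted from 0.\<close>

definition adj_swap :: "nat \<Rightarrow> 'a list \<Rightarrow> 'a list" where
  "adj_swap i p = p[i - 1 := p ! i, i := p ! (i - 1)]"

definition perm_edge :: "nat \<Rightarrow> nat \<Rightarrow> nat list \<Rightarrow> nat list \<Rightarrow> bool" where
  "perm_edge n i p q \<longleftrightarrow>
     p \<in> one_line_perms n \<and> q \<in> one_line_perms n \<and> i \<in> {1..n-1} \<and> q = adj_swap i p"

definition perm_adjacent :: "nat \<Rightarrow> nat list \<Rightarrow> nat list \<Rightarrow> bool" where
  "perm_adjacent n p q \<longleftrightarrow> (\<exists>i\<in>{1..n-1}. perm_edge n i p q)"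

text \<open>The list \<open>c\<close> is read cyclically: step \<open>k\<close> leads from \<open>c ! k\<close> to its cyclic
  successor. The bound on the length, automatic whenever \<open>r * (n - 1) \<ge> 3\<close>, excludes
  the empty list and walking back and forth along one edge, which are not cycles of a
  simple graph.\<close>

definition rainbow_cycle :: "nat \<Rightarrow> nat \<Rightarrow> nat list list \<Rightarrow> bool" where
  "rainbow_cycle n r c \<longleftrightarrow>
     3 \<le> length c \<and> distinct c \<and> set c \<subseteq> one_line_perms n \<and>
     (\<forall>k<length c. perm_adjacent n (c ! k) (c ! (Suc k mod length c))) \<and>
     (\<forall>i\<in>{1..n-1}.
        card {k. k < length c \<and> perm_edge n i (c ! k) (c ! (Suc k mod length c))} = r)"

end

theory Submission
  imports Defs
begin

text \<open>
  A rainbow cycle is a cyclic word in the adjacent transpositions. Fix one letter \<open>1\<close>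
  of such a word for \<open>n\<close> and write the word cyclically as \<open>w 1\<close>. For \<open>n \<ge> 3\<close>, the
  letter \<open>1\<close> commutes with all letters \<open>i \<ge> n\<close>. Hence \<open>n w n 1\<close> is again closed, with
  two further letters \<open>n\<close>, and so is \<open>b a b w a b a 1\<close> for \<open>a = n\<close> and \<open>b = n + 1\<close>, by
  the braid relation. No permutation is repeated, because the arrangement of the last
  entries tells the inserted steps apart. Iterating from one word for \<open>n = 5\<close> and from
  the hexagon for \<open>n = 3\<close>, respectively, gives all cases.
\<close>

section \<open>Walks along words in the adjacent transpositions\<close>

fun walk :: "'a list \<Rightarrow> nat list \<Rightarrow> 'a list list" where
  "walk p [] = [p]"
| "walk p (i # w) = p # walk (adj_swap i p) w"

abbreviation walk_end :: "'a list \<Rightarrow> nat list \<Rightarrow> 'a list" where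
  "walk_end p w \<equiv> fold adj_swap w p"

lemma length_adj_swap [simp]: "length (adj_swap i p) = length p"
  by (simp add: adj_swap_def)

lemma length_walk [simp]: "length (walk p w) = Suc (length w)"
  by (induction w arbitrary: p) auto

lemma length_walk_end [simp]: "length (walk_end p w) = length p"
  by (induction w arbitrary: p) auto

lemma nth_walk: "k \<le> length w \<Longrightarrow> walk p w ! k = walk_end p (take k w)"
  by (induction w arbitrary: p k) (auto simp: take_Cons nth_Cons split: nat.splits)

lemma walk_snoc: "walk p (w @ [i]) = walk p w @ [adj_swap i (walk_end p w)]"
  by (induction w arbitrary: p) auto

lemma adj_swap_append:
  assumes "1 \<le> i" "i < length p"
  shows "adj_swap i (p @ q) = adj_swap i p @ q"
  using assms by (auto simp: adj_swap_def nth_append list_update_append)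

text \<open>Letters below \<open>length p\<close> move only entries of \<open>p\<close>, so the
  suffix rides along unchanged. This is how a word for \<open>n\<close> acts on longer
  permutations.\<close>

lemma walk_append_list:
  assumes "set w \<subseteq> {1..<length p}"
  shows "walk (p @ q) w = map (\<lambda>x. x @ q) (walk p w)"
    and "walk_end (p @ q) w = walk_end p w @ q"
  using assms by (induction w arbitrary: p) (auto simp: adj_swap_append)

text \<open>Letters count positions from 1, so \<open>Suc (length p)\<close> exchanges the list
  indices \<open>length p\<close> and \<open>Suc (length p)\<close>. As a rewrite rule this
  evaluates letters acting behind a symbolic prefix.\<close>

lemma adj_swap_middle [simp]:
  "adj_swap (Suc (length p)) (p @ x # y # q) = p @ y # x # q"
  by (simp add: adj_swap_def nth_append list_update_append)

lemma adj_swap_involutive: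
  assumes "1 \<le> i" "i < length p"
  shows "adj_swap i (adj_swap i p) = p"
  using assms by (auto simp: adj_swap_def list_eq_iff_nth_eq nth_list_update)

lemma adj_swap_neq:
  assumes "distinct p" "1 \<le> i" "i < length p"
  shows "adj_swap i p \<noteq> p"
proof
  assume "adj_swap i p = p"
  hence "adj_swap i p ! i = p ! i" by simp
  thus False using assms by (auto simp: adj_swap_def nth_eq_iff_index_eq)
qed

text \<open>The endpoints of an edge thus determine its colour, so that counting the steps of a
  colour amounts to counting letters.\<close>

lemma adj_swap_inject:
  assumes "distinct p" "1 \<le> i" "i < length p" "1 \<le> j" "j < length p"
    and eq: "adj_swap i p = adj_swap j p"
  shows "i = j"
proof -
  have "i \<le> j" if "adj_swap i p = adj_swap j p" "1 \<le> i" "i < length p" "1 \<le> j" "j < length p" for i j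
  proof (rule ccontr)
    \<comment> \<open>For \<open>j < i\<close>, index \<open>i\<close> receives
      \<open>p ! (i - 1)\<close> on the left but keeps \<open>p ! i\<close> on the right.\<close>
    assume "\<not> i \<le> j"
    moreover have "adj_swap i p ! i = adj_swap j p ! i" using that by simp
    ultimately show False
      using that \<open>distinct p\<close> by (auto simp: adj_swap_def nth_eq_iff_index_eq)
  qed
  from this[of i j] this[of j i] show ?thesis using assms by simp
qed

lemma permutations_of_set_iff: "p \<in> permutations_of_set A \<longleftrightarrow> set p = A \<and> distinct p"
  by (auto simp: permutations_of_set_def)

lemma length_one_line_perm: "p \<in> one_line_perms n \<Longrightarrow> length p = n"
  using distinct_card[of p] by (auto simp: permutations_of_set_iff)

lemma adj_swap_in_perms:
  assumes "p \<in> one_line_perms n" "i \<in> {1..n-1}"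
  shows "adj_swap i p \<in> one_line_perms n"
proof -
  have "i - 1 < length p" "i < length p"
    using assms length_one_line_perm[OF assms(1)] by auto
  thus ?thesis
    using assms(1) unfolding permutations_of_set_iff adj_swap_def
    by (simp add: set_swap distinct_swap)
qed

lemma walk_end_in_perms:
  assumes "p \<in> one_line_perms n" "set w \<subseteq> {1..n-1}"
  shows "walk_end p w \<in> one_line_perms n"
  using assms
  by (induction w arbitrary: p) (auto intro: adj_swap_in_perms simp del: atLeastAtMost_iff One_nat_def)

lemma card_nth_eq: "card {k. k < length xs \<and> xs ! k = x} = count_list xs x"
proof -
  have "{k. k < length xs \<and> xs ! k = x} = {k. k < length xs \<and> x = xs ! k}"
    by auto
  thus ?thesis by (simp add: count_list_eq_length_filter length_filter_conv_card)
qed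

section \<open>Rainbow words\<close>

text \<open>The closing letter \<open>1\<close> is left out of \<open>w\<close>, so that
  \<open>walk p w\<close> lists each vertex of the cycle once; from the last vertex,
  \<open>adj_swap 1 p\<close>, the letter \<open>1\<close> leads back to \<open>p\<close>. Two
  letters in \<open>w\<close> give three vertices.\<close>

definition rainbow_word :: "nat \<Rightarrow> nat \<Rightarrow> nat list \<Rightarrow> nat list \<Rightarrow> bool" where
  "rainbow_word n r p w \<longleftrightarrow>
     p \<in> one_line_perms n \<and> set w \<subseteq> {1..n-1} \<and> 2 \<le> length w \<and>
     distinct (walk p w) \<and> walk_end p w = adj_swap 1 p \<and>
     (\<forall>i\<in>{1..n-1}. count_list (w @ [1]) i = r)"

lemma rainbow_word_imp_cycle:
  assumes w: "rainbow_word n r p w" and "3 \<le> n"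
  shows "rainbow_cycle n r (walk p w)"
proof -
  let ?c = "walk p w" and ?v = "w @ [1]"
  have p: "p \<in> one_line_perms n" and set_v: "set ?v \<subseteq> {1..n-1}"
    and closed: "walk_end p w = adj_swap 1 p"
    using w \<open>3 \<le> n\<close> by (auto simp: rainbow_word_def)
  have vertex: "?c ! k \<in> one_line_perms n" if "k < length ?c" for k
  proof -
    have "set (take k w) \<subseteq> {1..n-1}" using set_v set_take_subset[of k w] by auto
    thus ?thesis using that walk_end_in_perms[OF p, of "take k w"] by (simp add: nth_walk)
  qed
  have colour: "?v ! k \<in> {1..n-1}" if "k < length ?c" for k
    using that set_v by (metis length_append_singleton length_walk nth_mem subsetD)
  have step: "?c ! (Suc k mod length ?c) = adj_swap (?v ! k) (?c ! k)" if "k < length ?c" for k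
  proof (cases "k < length w")
    case True
    thus ?thesis by (simp add: nth_walk nth_append take_Suc_conv_app_nth)
  next
    case False
    \<comment> \<open>The closing step: the index wraps around to 0, and a second \<open>1\<close>
      undoes the first.\<close>
    hence "k = length w" using that by simp
    thus ?thesis
      using closed length_one_line_perm[OF p] \<open>3 \<le> n\<close>
      by (simp add: nth_walk adj_swap_involutive)
  qed
  have edge: "perm_edge n i (?c ! k) (?c ! (Suc k mod length ?c)) \<longleftrightarrow> ?v ! k = i"
    if k: "k < length ?c" for i k
  proof
    assume "?v ! k = i"
    thus "perm_edge n i (?c ! k) (?c ! (Suc k mod length ?c))"
      using vertex[OF k] colour[OF k] step[OF k] adj_swap_in_perms
      by (auto simp: perm_edge_def simp del: atLeastAtMost_iff)
  next
    assume "perm_edge n i (?c ! k) (?c ! (Suc k mod length ?c))"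
    hence "i \<in> {1..n-1}" "adj_swap (?v ! k) (?c ! k) = adj_swap i (?c ! k)"
      using step[OF k] by (auto simp: perm_edge_def)
    moreover have "distinct (?c ! k)" "length (?c ! k) = n"
      using vertex[OF k] length_one_line_perm by (auto simp: permutations_of_set_iff)
    ultimately show "?v ! k = i"
      using colour[OF k] by (intro adj_swap_inject[of "?c ! k"]) auto
  qed
  have adjacent: "\<forall>k<length ?c. perm_adjacent n (?c ! k) (?c ! (Suc k mod length ?c))"
    using edge colour unfolding perm_adjacent_def by blast
  have "card {k. k < length ?c \<and> perm_edge n i (?c ! k) (?c ! (Suc k mod length ?c))} = count_list ?v i" for i
  proof -
    have "{k. k < length ?c \<and> perm_edge n i (?c ! k) (?c ! (Suc k mod length ?c))}
      = {k. k < length ?v \<and> ?v ! k = i}"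
      using edge by auto
    thus ?thesis by (simp only: card_nth_eq)
  qed
  moreover have "set ?c \<subseteq> one_line_perms n"
    using vertex by (metis in_set_conv_nth subsetI)
  ultimately show ?thesis
    using w adjacent unfolding rainbow_cycle_def rainbow_word_def by simp
qed

section \<open>Extending a word by one or two larger entries\<close>

text \<open>As \<open>n \<ge> 3\<close>, the prefix \<open>p'\<close> has at least two entries, so
  the letter \<open>1\<close> acts inside \<open>p'\<close>, whereas letters from \<open>n\<close>
  on act only behind it. This is why they commute.\<close>

lemma rainbow_wordE:
  assumes "rainbow_word n r p w" "3 \<le> n"
  obtains p' z where "p = p' @ [z]" "length p' = n - 1" "adj_swap 1 p' \<noteq> p'" "z \<le> n"
    "walk_end p w = adj_swap 1 p' @ [z]" "set p' \<union> {z} = {1..n}" "distinct p'" "z \<notin> set p'"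
    "\<forall>x\<in>set p'. x \<le> n"
proof -
  have p: "p \<in> one_line_perms n" and closed: "walk_end p w = adj_swap 1 p"
    using assms(1) by (auto simp: rainbow_word_def)
  have len: "length p = n" by (rule length_one_line_perm[OF p])
  then obtain p' z where pz: "p = p' @ [z]"
    using \<open>3 \<le> n\<close> by (cases p rule: rev_cases) auto
  have "length p' = n - 1" using len pz by simp
  moreover have "distinct p'" "set p' \<union> {z} = {1..n}" "z \<notin> set p'"
    using p pz by (auto simp: permutations_of_set_iff)
  moreover from this(2) have "z \<le> n" "\<forall>x\<in>set p'. x \<le> n" by auto
  moreover have "walk_end p w = adj_swap 1 p' @ [z]"
    using closed pz \<open>length p' = n - 1\<close> \<open>3 \<le> n\<close> by (simp add: adj_swap_append)
  moreover have "adj_swap 1 p' \<noteq> p'"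
    using \<open>distinct p'\<close> \<open>length p' = n - 1\<close> \<open>3 \<le> n\<close> by (intro adj_swap_neq) auto
  ultimately show thesis using pz that by blast
qed

lemma rainbow_word_2_extend:
  assumes w: "rainbow_word n 2 p w" and n: "3 \<le> n"
  shows "\<exists>p w. rainbow_word (n + 1) 2 p w"
proof -
  obtain p' z where p: "p = p' @ [z]" "length p' = n - 1" "adj_swap 1 p' \<noteq> p'" "z \<le> n"
    "walk_end p w = adj_swap 1 p' @ [z]" "set p' \<union> {z} = {1..n}" "distinct p'" "z \<notin> set p'"
    "\<forall>x\<in>set p'. x \<le> n"
    by (rule rainbow_wordE[OF w n])
  \<comment> \<open>The new entry \<open>n + 1\<close> starts just before \<open>z\<close>. The
    first \<open>n\<close> moves it to the end, out of reach of \<open>w\<close>, and the last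
    \<open>n\<close> moves it back.\<close>
  let ?q = "p' @ [n + 1, z]" and ?w = "n # w @ [n]"
  have set_w: "set w \<subseteq> {1..n-1}" and dist: "distinct (walk p w)"
    and cnt: "\<And>i. i \<in> {1..n-1} \<Longrightarrow> count_list (w @ [1]) i = 2"
    using w by (auto simp: rainbow_word_def)
  have len_w: "2 \<le> length w" using w by (simp add: rainbow_word_def)
  have swap: "adj_swap n (x @ [u, v]) = x @ [v, u]" if "length x = n - 1" for x and u v :: nat
    using adj_swap_middle[of x u v "[]"] that n by simp
  have "{1..n-1} = {1..<length p}" using p n by auto
  with set_w have "set w \<subseteq> {1..<length p}" by simp
  from walk_append_list[OF this, of "[n + 1]"]
  have lift: "walk (p' @ [z, n + 1]) w = map (\<lambda>x. x @ [n + 1]) (walk p w)"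
    "walk_end (p' @ [z, n + 1]) w = adj_swap 1 p' @ [z, n + 1]"
    using p by simp_all
  have walk: "walk ?q ?w = ?q # map (\<lambda>x. x @ [n + 1]) (walk p w) @ [adj_swap 1 p' @ [n + 1, z]]"
    using p(2) by (simp add: swap walk_snoc lift del: One_nat_def)
  have "distinct (map (\<lambda>x. x @ [n + 1]) (walk p w))"
    using dist by (simp add: distinct_map inj_on_def)
  \<comment> \<open>The inner vertices end in \<open>n + 1\<close>, the two outer ones in
    \<open>z \<le> n\<close>; the outer ones differ because
    \<open>adj_swap 1 p' \<noteq> p'\<close>.\<close>
  hence "distinct (walk ?q ?w)"
    unfolding walk using p by auto
  moreover have "?q \<in> one_line_perms (n + 1)"
  proof -
    have "set ?q = insert (n + 1) (set p' \<union> {z})" by auto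
    also have "\<dots> = {1..n + 1}" unfolding p(6) by auto
    finally have "set ?q = {1..n + 1}" .
    moreover have "distinct ?q" using p(4,7-9) by (auto)
    ultimately show ?thesis unfolding permutations_of_set_iff by blast
  qed
  moreover have "walk_end ?q ?w = adj_swap 1 ?q"
    using p(2) n by (simp add: swap lift adj_swap_append del: One_nat_def)
  moreover have "count_list (?w @ [1]) i = 2" if "i \<in> {1..n+1-1}" for i
  proof (cases "i = n")
    case True
    have "n \<notin> set w" using set_w n by auto
    thus ?thesis using True n by (simp add: count_notin)
  next
    case False
    thus ?thesis using cnt[of i] that by auto
  qed
  moreover have "set ?w \<subseteq> {1..n + 1-1}"
    using subsetD[OF set_w] n by (fastforce)
  moreover have "2 \<le> length ?w" using len_w by simp
  ultimately have "rainbow_word (n + 1) 2 ?q ?w"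
    unfolding rainbow_word_def by blast
  thus ?thesis by blast
qed

lemma rainbow_word_3_extend:
  assumes w: "rainbow_word n 3 p w" and n: "3 \<le> n"
  shows "\<exists>p w. rainbow_word (n + 2) 3 p w"
proof -
  obtain p' z where p: "p = p' @ [z]" "length p' = n - 1" "adj_swap 1 p' \<noteq> p'" "z \<le> n"
    "walk_end p w = adj_swap 1 p' @ [z]" "set p' \<union> {z} = {1..n}" "distinct p'" "z \<notin> set p'"
    "\<forall>x\<in>set p'. x \<le> n"
    by (rule rainbow_wordE[OF w n])
  define a b where "a = n" and "b = n + 1"
  define A B where "A = n + 1" and "B = n + 2"
  let ?l = "adj_swap 1 p'"
  \<comment> \<open>Both \<open>b a b\<close> and \<open>a b a\<close> reverse the last three
    entries: the first leads from \<open>[B, A, z]\<close> to \<open>[z, A, B]\<close>, the second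
    back. Taking one of each makes both letters occur three times.\<close>
  let ?q = "p' @ [B, A, z]" and ?w = "[b, a, b] @ w @ [a, b, a]"
  have set_w: "set w \<subseteq> {1..n-1}" and dist: "distinct (walk p w)"
    and cnt: "\<And>i. i \<in> {1..n-1} \<Longrightarrow> count_list (w @ [1]) i = 3"
    using w by (auto simp: rainbow_word_def)
  have len_w: "2 \<le> length w" using w by (simp add: rainbow_word_def)
  have swap: "adj_swap a (x @ [s, t, u]) = x @ [t, s, u]"
    "adj_swap b (x @ [s, t, u]) = x @ [s, u, t]" if "length x = n - 1" for x and s t u :: nat
    using adj_swap_middle[of x s t "[u]"] adj_swap_middle[of "x @ [s]" t u "[]"] that n
    by (simp_all add: a_def b_def)
  note swaps = swap[OF p(2)] swap[of ?l, unfolded length_adj_swap, OF p(2)]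
  have "{1..n-1} = {1..<length p}" using p n by auto
  with set_w have "set w \<subseteq> {1..<length p}" by simp
  from walk_append_list[OF this, of "[A, B]"]
  have lift: "walk (p' @ [z, A, B]) w = map (\<lambda>x. x @ [A, B]) (walk p w)"
    "walk_end (p' @ [z, A, B]) w = ?l @ [z, A, B]"
    using p by simp_all
  \<comment> \<open>Splits off the trailing letters one at a time, as \<open>walk_snoc\<close>
    needs.\<close>
  have snoc3: "xs @ [x, y, t] = ((xs @ [x]) @ [y]) @ [t]" for xs and x y t :: nat
    by simp
  have walk: "walk ?q ?w = [?q, p' @ [B, z, A], p' @ [z, B, A]]
      @ map (\<lambda>x. x @ [A, B]) (walk p w)
      @ [?l @ [A, z, B], ?l @ [A, B, z], ?l @ [B, A, z]]"
    unfolding snoc3[of w] by (simp add: swaps walk_snoc lift del: One_nat_def append_assoc)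
  have ends: "A \<noteq> B" "z \<noteq> A" "z \<noteq> B" using p by (auto simp: A_def B_def)
  have "distinct (map (\<lambda>x. x @ [A, B]) (walk p w))"
    using dist by (simp add: distinct_map inj_on_def)
  moreover have "ys @ [s, t, u] \<notin> set (map (\<lambda>x. x @ [A, B]) (walk p w))"
    if "[t, u] \<noteq> [A, B]" for ys s t u
    using that append_eq_append_conv[of "[t, u]" "[A, B]" "ys @ [s]"] by auto
  \<comment> \<open>None of the six outer vertices ends in \<open>[A, B]\<close>. Among their last
    three entries only \<open>[B, A, z]\<close> occurs twice, after \<open>p'\<close> and after
    \<open>?l\<close>, which differ.\<close>
  ultimately have "distinct (walk ?q ?w)"
    unfolding walk using p ends by auto
  moreover have "?q \<in> one_line_perms (n + 2)"
  proof -
    have "set ?q = {A, B} \<union> (set p' \<union> {z})" by auto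
    also have "\<dots> = {1..n + 2}" unfolding p(6) A_def B_def by auto
    finally have "set ?q = {1..n + 2}" .
    moreover have "distinct ?q" using p(4,7-9) by (auto simp: A_def B_def)
    ultimately show ?thesis unfolding permutations_of_set_iff by blast
  qed
  moreover have "walk_end ?q ?w = adj_swap 1 ?q"
    using p n by (simp add: swaps lift adj_swap_append del: One_nat_def)
  moreover have "count_list (?w @ [1]) i = 3" if "i \<in> {1..n+2-1}" for i
  proof (cases "i < n")
    case True
    thus ?thesis using cnt[of i] that by (auto simp: a_def b_def)
  next
    case False
    hence "i = a \<or> i = b" using that by (auto simp: a_def b_def)
    moreover have "a \<notin> set w" "b \<notin> set w" using set_w n by (auto simp: a_def b_def)
    ultimately show ?thesis using n by (auto simp: count_notin a_def b_def)
  qed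
  moreover have "set ?w \<subseteq> {1..n + 2-1}"
    using subsetD[OF set_w] n by (fastforce simp: a_def b_def)
  moreover have "2 \<le> length ?w" using len_w by simp
  ultimately have "rainbow_word (n + 2) 3 ?q ?w"
    unfolding rainbow_word_def by blast
  thus ?thesis by blast
qed

section \<open>Starting words and induction\<close>

text \<open>The word collapses to \<open>1\<close> by commutation alone: \<open>2 4 2\<close> acts
  as \<open>4\<close>, \<open>3 1 3\<close> as \<open>1\<close>, and then \<open>4 1 4\<close> as
  \<open>1\<close>.\<close>

lemma rainbow_word_5: "rainbow_word 5 2 [1, 2, 3, 4, 5] [2, 4, 2, 3, 1, 3, 4]"
proof -
  have "{1..5} = {1, 2, 3, 4, 5::nat}" "{1..4} = {1, 2, 3, 4::nat}" by auto
  thus ?thesis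
    by (simp add: rainbow_word_def permutations_of_set_iff adj_swap_def)
qed

text \<open>With the closing \<open>1\<close>, the letters \<open>2\<close> and \<open>1\<close>
  alternate around the hexagon of all six permutations.\<close>

lemma rainbow_word_3: "rainbow_word 3 3 [1, 2, 3] [2, 1, 2, 1, 2]"
proof -
  have "{1..3} = {1, 2, 3::nat}" "{1..2} = {1, 2::nat}" by auto
  thus ?thesis
    by (simp add: rainbow_word_def permutations_of_set_iff adj_swap_def)
qed

lemma ex_rainbow_word_2: "5 \<le> n \<Longrightarrow> \<exists>p w. rainbow_word n 2 p w"
proof (induction n rule: dec_induct)
  case base
  show ?case using rainbow_word_5 by blast
next
  case (step n)
  thus ?case using rainbow_word_2_extend[of n] by fastforce
qed

text \<open>Each extension adds two entries, so odd \<open>n\<close> are written as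
  \<open>2 * m + 3\<close> to allow plain induction on \<open>m\<close>.\<close>

lemma ex_rainbow_word_3: "\<exists>p w. rainbow_word (2 * m + 3) 3 p w"
proof (induction m)
  case 0
  show ?case using rainbow_word_3 by auto
next
  case (Suc m)
  thus ?case using rainbow_word_3_extend[of "2 * m + 3"] by fastforce
qed

theorem theorem2p4:
  shows "(\<forall>n\<ge>5. \<exists>c. rainbow_cycle n 2 c) \<and>
         (\<forall>n\<ge>3. odd n \<longrightarrow> (\<exists>c. rainbow_cycle n 3 c))"
proof (intro conjI allI impI)
  fix n :: nat
  assume n: "5 \<le> n"
  thus "\<exists>c. rainbow_cycle n 2 c"
    using ex_rainbow_word_2[OF n] rainbow_word_imp_cycle[of n 2] by auto
next
  fix n :: nat
  assume n: "3 \<le> n" "odd n"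
  hence "n = 2 * ((n - 3) div 2) + 3" by presburger
  then obtain m where "n = 2 * m + 3" by blast
  thus "\<exists>c. rainbow_cycle n 3 c"
    using ex_rainbow_word_3[of m] rainbow_word_imp_cycle[of n 3] n by auto
qed

end
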